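(* Let $\alpha,\beta,\gamma,p,x,y\in\mathbb{C}$ with $\mathrm{Re}(\alpha)>0$, $\mathrm{Re}(p)>0$, $\mathrm{Re}(x)>0$, $\mathrm{Re}(y)>0$. Then $${}^{ML}\Gamma_{p}(x)\,{}^{ML}\Gamma_{p}(y)=4\int_{0}^{\pi/2}\int_{0}^{\infty} r^{2(x+y)-1} \cos^{2x-1}\theta\, \sin^{2y-1}\theta\; E_{\alpha,\beta}^{\gamma}\left(-r^2\cos^2\theta -\frac{p}{r^2\cos^2\theta}\right) E_{\alpha,\beta}^{\gamma}\left(-r^2\sin^2\theta -\frac{p}{r^2\sin^2\theta}\right)dr\,d\theta.$$
   Context: The three-parameter Mittag-Leffler function is $E_{\alpha,\beta}^{\gamma}(z)=\sum_{n=0}^{\infty}\frac{(\gamma)_n}{\Gamma(\alpha n+\beta)}\frac{z^n}{n!}$ for $\alpha,\beta,\gamma\in\mathbb{C}$, $\mathrm{Re}(\alpha)>0$, where $(\gamma)_n=\gamma(\gamma+1)\cdots(\gamma+n-1)$, $(\gamma)_0=1$. The ML-generalized gamma function is ${}^{ML}\Gamma_{p}(x)=\int_{0}^{\infty}t^{x-1}E_{\alpha,\beta}^{\gamma}\left(-t-\frac{p}{t}\right)dt$ for $\mathrm{Re}(p)>0$, $\mathrm{Re}(x)>0$, $\mathrm{Re}(\alpha)>0$ (the parameters $\alpha,\beta,\gamma$ are suppressed in the notation).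
   Formalization: The integrals defining the ML-generalized gamma function at x and at y are assumed to converge absolutely; this does not follow from the positivity conditions (for γ = 0, β = 1 the integrand is t^(x-1), whose integral diverges). *)

theory Defs
  imports "HOL-Analysis.Analysis"
begin

text \<open>
  The library sets \<^term>\<open>Gamma z = 0\<close> at the poles and \<^term>\<open>a / 0 = 0\<close>, so a term for which
  \<open>\<alpha> n + \<beta>\<close> is a pole of Gamma vanishes, as it does under the usual convention \<open>1 / \<Gamma> = 0\<close>
  there (compare \<^const>\<open>rGamma\<close>).
\<close>
definition mittag_leffler :: "complex \<Rightarrow> complex \<Rightarrow> complex \<Rightarrow> complex \<Rightarrow> complex" where
  "mittag_leffler \<alpha> \<beta> \<gamma> z =
     (\<Sum>n. pochhammer \<gamma> n / Gamma (\<alpha> * of_nat n + \<beta>) * (z ^ n / fact n))"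

definition gamma_ML_integrand ::
    "complex \<Rightarrow> complex \<Rightarrow> complex \<Rightarrow> complex \<Rightarrow> complex \<Rightarrow> real \<Rightarrow> complex" where
  "gamma_ML_integrand \<alpha> \<beta> \<gamma> p x t =
     of_real t powr (x - 1) * mittag_leffler \<alpha> \<beta> \<gamma> (- of_real t - p / of_real t)"

text \<open>
  The integrals are Lebesgue integrals, which are 0 by convention when the integrand is not
  absolutely integrable. Positivity of the real parts of \<open>\<alpha>\<close>, \<open>p\<close>, \<open>x\<close> does not ensure
  integrability: for \<open>\<alpha> = 1/2\<close> and \<open>\<beta> = \<gamma> = 1\<close> the integrand is of exact order
  \<open>t powr (Re x - 2)\<close> at infinity, so the integral exists only if \<open>Re x < 1\<close>. The predicate
  \<open>gamma_ML_exists\<close> says that the value of \<open>gamma_ML\<close> is a genuine integral.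
\<close>
definition gamma_ML_exists ::
    "complex \<Rightarrow> complex \<Rightarrow> complex \<Rightarrow> complex \<Rightarrow> complex \<Rightarrow> bool" where
  "gamma_ML_exists \<alpha> \<beta> \<gamma> p x \<longleftrightarrow>
     set_integrable lborel {0<..} (gamma_ML_integrand \<alpha> \<beta> \<gamma> p x)"

definition gamma_ML ::
    "complex \<Rightarrow> complex \<Rightarrow> complex \<Rightarrow> complex \<Rightarrow> complex \<Rightarrow> complex" where
  "gamma_ML \<alpha> \<beta> \<gamma> p x = (LINT t:{0<..}|lborel. gamma_ML_integrand \<alpha> \<beta> \<gamma> p x t)"

end

theory Submission
  imports Defs
begin

text \<open>
  The product of the two integrals is, by Fubini, the integral of \<open>f(u) g(v)\<close> over the open
  quadrant, and the claim is the change of variables \<open>u = r\<^sup>2 cos\<^sup>2 \<theta>\<close>, \<open>v = r\<^sup>2 sin\<^sup>2 \<theta>\<close> with Jacobian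
  \<open>4 r\<^sup>3 cos \<theta> sin \<theta>\<close>. For nonnegative integrands this reduces to the one-dimensional substitutions
  \<open>v = u w\<close>, \<open>w = tan\<^sup>2 \<theta>\<close> and \<open>u = r\<^sup>2 cos\<^sup>2 \<theta>\<close>, with an exchange of the order of integration after
  the first. The resulting equality of measures transfers integrability and integrals
  to complex integrands.
\<close>

section \<open>Change of variables on the line for nonnegative integrands\<close>

text \<open>A nonnegative Borel function fails to be absolutely integrable exactly when its
  nonnegative integral is infinite. This translates statements about
  \<open>absolutely_integrable_on\<close> and \<open>integral\<close> into equations in
  \<open>ennreal\<close> that carry no integrability hypothesis.\<close>

lemma nn_integral_indicator_eq_integral:
  fixes f :: "real \<Rightarrow> real"
  assumes [measurable]: "f \<in> borel_measurable borel" "T \<in> sets borel"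
    and nonneg: "\<And>x. x \<in> T \<Longrightarrow> 0 \<le> f x"
  shows "(\<integral>\<^sup>+x. ennreal (f x) * indicator T x \<partial>lborel) =
           (if f absolutely_integrable_on T then ennreal (integral T f) else \<infinity>)"
proof (cases "f absolutely_integrable_on T")
  case True
  then have "(f has_integral integral T f) T"
    using set_lebesgue_integral_eq_integral(1) by blast
  from nn_integral_has_integral_lebesgue'[OF nonneg this] True show ?thesis by simp
next
  case False
  \<comment> \<open>\<open>absolutely_integrable_on\<close> refers to the completed measure
    \<open>lebesgue\<close>; for Borel measurable functions integrability there and over
    \<open>lborel\<close> coincide.\<close>
  then have "\<not> integrable lborel (\<lambda>x. indicator T x *\<^sub>R f x)"
    by (simp add: set_integrable_def integrable_completion)
  then have "(\<integral>\<^sup>+x. ennreal (norm (indicator T x *\<^sub>R f x)) \<partial>lborel) = \<infinity>"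
    by (simp add: integrable_iff_bounded less_top[symmetric])
  also have "(\<integral>\<^sup>+x. ennreal (norm (indicator T x *\<^sub>R f x)) \<partial>lborel) =
      (\<integral>\<^sup>+x. ennreal (f x) * indicator T x \<partial>lborel)"
    by (intro nn_integral_cong) (auto split: split_indicator simp: nonneg)
  finally show ?thesis using False by simp
qed

text \<open>The substitution rule for real functions is applied only to indicators of Borel sets,
  which shows that two measures are equal. Integrating \<open>f\<close> against both then covers
  every measurable \<open>f\<close>, infinite values included.\<close>

lemma nn_integral_change_of_variables_inj_on:
  fixes g h :: "real \<Rightarrow> real" and f :: "real \<Rightarrow> ennreal"
  assumes [measurable]: "S \<in> sets borel" "g ` S \<in> sets borel" "g \<in> borel_measurable borel"
      "h \<in> borel_measurable borel" "f \<in> borel_measurable borel"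
    and der: "\<And>x. x \<in> S \<Longrightarrow> (g has_field_derivative h x) (at x)"
    and inj: "inj_on g S"
  shows "(\<integral>\<^sup>+u. f u * indicator (g ` S) u \<partial>lborel) =
         (\<integral>\<^sup>+x. ennreal \<bar>h x\<bar> * f (g x) * indicator S x \<partial>lborel)"
proof -
  have "density lborel (indicator (g ` S)) =
        distr (density lborel (\<lambda>x. ennreal \<bar>h x\<bar> * indicator S x)) borel g"
  proof (rule measure_eqI)
    fix A assume "A \<in> sets (density lborel (indicator (g ` S)))"
    then have A [measurable]: "A \<in> sets borel" by simp
    have der': "(g has_field_derivative h x) (at x within S)" if "x \<in> S" for x
      using der[OF that] by (rule has_field_derivative_at_within)
    have "emeasure (density lborel (indicator (g ` S))) A =
        (\<integral>\<^sup>+u. ennreal (indicator A u) * indicator (g ` S) u \<partial>lborel)"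
      by (subst emeasure_density)
        (auto intro!: nn_integral_cong split: split_indicator)
    \<comment> \<open>The first rule makes integrability on the two sides equivalent, the second
      equates the values when it holds. Hence both \<open>if\<close> expressions agree in either
      branch.\<close>
    also have "\<dots> = (\<integral>\<^sup>+x. ennreal (\<bar>h x\<bar> * indicator A (g x)) * indicator S x \<partial>lborel)"
      using absolutely_integrable_change_of_variables_1'[OF _ der' inj, of "indicator A"]
        has_absolute_integral_change_of_variables_1'[OF _ der' inj, of "indicator A"
          "integral (g ` S) (indicator A)"]
      by (subst (1 2) nn_integral_indicator_eq_integral) auto
    also have "\<dots> = emeasure (distr (density lborel (\<lambda>x. ennreal \<bar>h x\<bar> * indicator S x)) borel g) A"
      by (subst nn_integral_indicator[symmetric])
        (auto intro!: nn_integral_cong split: split_indicator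
          simp: nn_integral_distr nn_integral_density simp del: nn_integral_indicator)
    finally show "emeasure (density lborel (indicator (g ` S))) A =
        emeasure (distr (density lborel (\<lambda>x. ennreal \<bar>h x\<bar> * indicator S x)) borel g) A" .
  qed simp
  then have "integral\<^sup>N (density lborel (indicator (g ` S))) f =
      integral\<^sup>N (distr (density lborel (\<lambda>x. ennreal \<bar>h x\<bar> * indicator S x)) borel g) f"
    by simp
  then show ?thesis
    by (simp add: nn_integral_density nn_integral_distr ac_simps)
qed

section \<open>Squared polar coordinates on the open quadrant\<close>

text \<open>On this interval \<open>tan\<close> is positive, so its square determines it and
  \<open>arctan\<close> recovers the angle; \<open>arctan (sqrt w)\<close> is a preimage of
  \<open>w\<close>. The quotient form lets \<open>(cos \<theta>)\<^sup>2\<close> cancel once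
  \<open>u = r\<^sup>2 * (cos \<theta>)\<^sup>2\<close> is substituted.\<close>

lemma inj_on_and_image_tan_square:
  "inj_on (\<lambda>\<theta>::real. (sin \<theta>)\<^sup>2 / (cos \<theta>)\<^sup>2) {0<..<pi/2}"
  "(\<lambda>\<theta>::real. (sin \<theta>)\<^sup>2 / (cos \<theta>)\<^sup>2) ` {0<..<pi/2} = {0<..}"
proof -
  have tan: "(sin \<theta>)\<^sup>2 / (cos \<theta>)\<^sup>2 = (tan \<theta>)\<^sup>2" for \<theta> :: real
    by (simp add: tan_def power_divide)
  have "\<theta> = \<theta>'" if "\<theta> \<in> {0<..<pi/2}" "\<theta>' \<in> {0<..<pi/2}" "(tan \<theta>)\<^sup>2 = (tan \<theta>')\<^sup>2" for \<theta> \<theta>' :: real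
  proof -
    have "tan \<theta> = tan \<theta>'"
      using that tan_gt_zero[of \<theta>] tan_gt_zero[of \<theta>'] by (simp add: power2_eq_iff)
    then have "arctan (tan \<theta>) = arctan (tan \<theta>')" by simp
    then show ?thesis using that by (simp add: arctan_tan)
  qed
  then show "inj_on (\<lambda>\<theta>::real. (sin \<theta>)\<^sup>2 / (cos \<theta>)\<^sup>2) {0<..<pi/2}"
    unfolding tan by (auto intro!: inj_onI)
  show "(\<lambda>\<theta>::real. (sin \<theta>)\<^sup>2 / (cos \<theta>)\<^sup>2) ` {0<..<pi/2} = {0<..}"
    unfolding tan
  proof (intro equalityI subsetI)
    fix w :: real assume "w \<in> {0<..}"
    then show "w \<in> (\<lambda>\<theta>. (tan \<theta>)\<^sup>2) ` {0<..<pi/2}"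
      using arctan_ubound[of "sqrt w"]
      by (intro image_eqI[of _ _ "arctan (sqrt w)"]) (auto simp: tan_arctan)
  qed (use tan_gt_zero in force)
qed

lemma image_mult_square_greaterThan_0:
  fixes k :: real
  assumes "k > 0"
  shows "(\<lambda>r. r\<^sup>2 * k) ` {0<..} = {0<..}"
proof (intro equalityI subsetI)
  fix w :: real assume "w \<in> {0<..}"
  then show "w \<in> (\<lambda>r. r\<^sup>2 * k) ` {0<..}"
    using assms by (intro image_eqI[of _ _ "sqrt (w / k)"]) auto
qed (use assms in auto)

text \<open>Working with nonnegative functions splits the planar substitution into one-dimensional
  ones, and the exchange of integrals between them needs no integrability condition.\<close>

lemma nn_integral_quadrant_polar_squared:
  fixes f :: "real \<times> real \<Rightarrow> ennreal"
  assumes [measurable]: "f \<in> borel_measurable (lborel \<Otimes>\<^sub>M lborel)"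
  shows "(\<integral>\<^sup>+u. (\<integral>\<^sup>+v. f (u, v) * indicator {0<..} v \<partial>lborel) * indicator {0<..} u \<partial>lborel) =
    (\<integral>\<^sup>+\<theta>. (\<integral>\<^sup>+r. ennreal (4 * r ^ 3 * cos \<theta> * sin \<theta>) *
       f (r\<^sup>2 * (cos \<theta>)\<^sup>2, r\<^sup>2 * (sin \<theta>)\<^sup>2) * indicator {0<..} r \<partial>lborel)
       * indicator {0<..<pi/2} \<theta> \<partial>lborel)"
    (is "?L = ?R")
proof -
  \<comment> \<open>The inner substitution \<open>v = u * w\<close> at fixed \<open>u > 0\<close>
    contributes the factor \<open>u\<close>.\<close>
  have "?L = (\<integral>\<^sup>+u. (\<integral>\<^sup>+w. ennreal \<bar>u\<bar> * f (u, u * w) * indicator {0<..} w \<partial>lborel)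
                * indicator {0<..} u \<partial>lborel)"
  proof (intro nn_integral_cong)
    fix u :: real
    show "(\<integral>\<^sup>+v. f (u, v) * indicator {0<..} v \<partial>lborel) * indicator {0<..} u =
      (\<integral>\<^sup>+w. ennreal \<bar>u\<bar> * f (u, u * w) * indicator {0<..} w \<partial>lborel) * indicator {0<..} u"
    proof (cases "u > 0")
      case True
      have im: "(\<lambda>w. u * w) ` {0<..} = {0<..}"
      proof (intro equalityI subsetI)
        fix w :: real assume "w \<in> {0<..}"
        then show "w \<in> (\<lambda>w. u * w) ` {0<..}"
          using True by (intro image_eqI[of _ _ "w / u"]) auto
      qed (use True in auto)
      show ?thesis
        using nn_integral_change_of_variables_inj_on[of "{0<..}" "\<lambda>w. u * w" "\<lambda>_. u" "\<lambda>v. f (u, v)"] True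
        by (simp add: im inj_on_def DERIV_cmult_Id)
    qed simp
  qed
  \<comment> \<open>The ratio \<open>w = v / u\<close> will depend on the angle alone, so it has to
    become the outer variable; the substitution for \<open>u\<close> may then depend on
    \<theta>.\<close>
  also have "\<dots> = (\<integral>\<^sup>+w. (\<integral>\<^sup>+u. ennreal \<bar>u\<bar> * f (u, u * w) * indicator {0<..} u \<partial>lborel)
                * indicator {0<..} w \<partial>lborel)"
  proof -
    have "(\<integral>\<^sup>+u. (\<integral>\<^sup>+w. ennreal \<bar>u\<bar> * f (u, u * w) * indicator {0<..} w \<partial>lborel)
                * indicator {0<..} u \<partial>lborel) =
      (\<integral>\<^sup>+u. (\<integral>\<^sup>+w. ennreal \<bar>u\<bar> * f (u, u * w) * indicator {0<..} w * indicator {0<..} u \<partial>lborel) \<partial>lborel)"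
      by (simp add: nn_integral_multc)
    also have "\<dots> =
      (\<integral>\<^sup>+w. (\<integral>\<^sup>+u. ennreal \<bar>u\<bar> * f (u, u * w) * indicator {0<..} w * indicator {0<..} u \<partial>lborel) \<partial>lborel)"
      by (rule lborel_pair.Fubini'[symmetric]) measurable
    also have "\<dots> =
      (\<integral>\<^sup>+w. (\<integral>\<^sup>+u. ennreal \<bar>u\<bar> * f (u, u * w) * indicator {0<..} u * indicator {0<..} w \<partial>lborel) \<partial>lborel)"
      by (simp add: ac_simps)
    finally show ?thesis by (simp add: nn_integral_multc)
  qed
  also have "\<dots> = (\<integral>\<^sup>+\<theta>. ennreal \<bar>2 * sin \<theta> / (cos \<theta>) ^ 3\<bar> *
       (\<integral>\<^sup>+u. ennreal \<bar>u\<bar> * f (u, u * ((sin \<theta>)\<^sup>2 / (cos \<theta>)\<^sup>2)) * indicator {0<..} u \<partial>lborel)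
       * indicator {0<..<pi/2} \<theta> \<partial>lborel)"
  proof -
    have der: "((\<lambda>\<theta>. (sin \<theta>)\<^sup>2 / (cos \<theta>)\<^sup>2) has_field_derivative 2 * sin \<theta> / (cos \<theta>) ^ 3) (at \<theta>)"
      if "\<theta> \<in> {0<..<pi/2}" for \<theta> :: real
    proof -
      have c: "cos \<theta> > 0" using that cos_gt_zero by auto
      \<comment> \<open>This is the numerator from the quotient rule; the Pythagorean identity
        reduces it to \<open>2 * sin \<theta> * cos \<theta>\<close>, over a denominator
        \<open>(cos \<theta>) ^ 4\<close>.\<close>
      have "2 * sin \<theta> * cos \<theta> * (cos \<theta>)\<^sup>2 + 2 * cos \<theta> * sin \<theta> * (sin \<theta>)\<^sup>2 =
          2 * sin \<theta> * cos \<theta> * ((sin \<theta>)\<^sup>2 + (cos \<theta>)\<^sup>2)"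
        by (simp only: algebra_simps)
      then show ?thesis
        using c by (auto intro!: derivative_eq_intros simp: field_simps power2_eq_square power3_eq_cube)
    qed
    show ?thesis
      using nn_integral_change_of_variables_inj_on[of "{0<..<pi/2}" "\<lambda>\<theta>. (sin \<theta>)\<^sup>2 / (cos \<theta>)\<^sup>2"
          "\<lambda>\<theta>. 2 * sin \<theta> / (cos \<theta>) ^ 3"
          "\<lambda>w. (\<integral>\<^sup>+u. ennreal \<bar>u\<bar> * f (u, u * w) * indicator {0<..} u \<partial>lborel)"]
      by (simp add: inj_on_and_image_tan_square der)
  qed
  also have "\<dots> = ?R"
  proof (intro nn_integral_cong)
    fix \<theta> :: real
    show "ennreal \<bar>2 * sin \<theta> / (cos \<theta>) ^ 3\<bar> *
       (\<integral>\<^sup>+u. ennreal \<bar>u\<bar> * f (u, u * ((sin \<theta>)\<^sup>2 / (cos \<theta>)\<^sup>2)) * indicator {0<..} u \<partial>lborel)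
       * indicator {0<..<pi/2} \<theta> =
      (\<integral>\<^sup>+r. ennreal (4 * r ^ 3 * cos \<theta> * sin \<theta>) *
       f (r\<^sup>2 * (cos \<theta>)\<^sup>2, r\<^sup>2 * (sin \<theta>)\<^sup>2) * indicator {0<..} r \<partial>lborel)
       * indicator {0<..<pi/2} \<theta>"
    proof (cases "\<theta> \<in> {0<..<pi/2}")
      case True
      then have c: "cos \<theta> > 0" and s: "sin \<theta> > 0"
        using cos_gt_zero sin_gt_zero by auto
      let ?g = "\<lambda>u. ennreal \<bar>u\<bar> * f (u, u * ((sin \<theta>)\<^sup>2 / (cos \<theta>)\<^sup>2))"
      have "(\<integral>\<^sup>+u. ?g u * indicator {0<..} u \<partial>lborel) =
        (\<integral>\<^sup>+r. ennreal \<bar>2 * r * (cos \<theta>)\<^sup>2\<bar> * ?g (r\<^sup>2 * (cos \<theta>)\<^sup>2) * indicator {0<..} r \<partial>lborel)"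
      proof -
        have "inj_on (\<lambda>r. r\<^sup>2 * (cos \<theta>)\<^sup>2) {0<..}"
          using c by (auto simp: inj_on_def power2_eq_iff)
        moreover have "((\<lambda>r. r\<^sup>2 * (cos \<theta>)\<^sup>2) has_field_derivative 2 * r * (cos \<theta>)\<^sup>2) (at r)" for r
          by (auto intro!: derivative_eq_intros)
        ultimately show ?thesis
          using nn_integral_change_of_variables_inj_on[of "{0<..}" "\<lambda>r. r\<^sup>2 * (cos \<theta>)\<^sup>2"
              "\<lambda>r. 2 * r * (cos \<theta>)\<^sup>2" ?g] c
          by (simp add: image_mult_square_greaterThan_0)
      qed
      then have "ennreal \<bar>2 * sin \<theta> / (cos \<theta>) ^ 3\<bar> * (\<integral>\<^sup>+u. ?g u * indicator {0<..} u \<partial>lborel) =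
        (\<integral>\<^sup>+r. ennreal \<bar>2 * sin \<theta> / (cos \<theta>) ^ 3\<bar> *
           (ennreal \<bar>2 * r * (cos \<theta>)\<^sup>2\<bar> * ?g (r\<^sup>2 * (cos \<theta>)\<^sup>2) * indicator {0<..} r) \<partial>lborel)"
        by (simp add: nn_integral_cmult)
      also have "\<dots> = (\<integral>\<^sup>+r. ennreal (4 * r ^ 3 * cos \<theta> * sin \<theta>) *
          f (r\<^sup>2 * (cos \<theta>)\<^sup>2, r\<^sup>2 * (sin \<theta>)\<^sup>2) * indicator {0<..} r \<partial>lborel)"
      proof (intro nn_integral_cong)
        fix r :: real
        have "ennreal \<bar>2 * sin \<theta> / (cos \<theta>) ^ 3\<bar> * (ennreal \<bar>2 * r * (cos \<theta>)\<^sup>2\<bar> * ennreal \<bar>r\<^sup>2 * (cos \<theta>)\<^sup>2\<bar>)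
            = ennreal (4 * r ^ 3 * cos \<theta> * sin \<theta>)" if "r > 0"
        proof -
          \<comment> \<open>The three factors come from
            \<open>w = (sin \<theta>)\<^sup>2 / (cos \<theta>)\<^sup>2\<close>, from
            \<open>u = r\<^sup>2 * (cos \<theta>)\<^sup>2\<close> and from \<open>v = u * w\<close>,
            the last being \<open>u\<close> itself in the new variables.\<close>
          have "2 * sin \<theta> / (cos \<theta>) ^ 3 * ((2 * r * (cos \<theta>)\<^sup>2) * (r\<^sup>2 * (cos \<theta>)\<^sup>2)) =
             4 * r ^ 3 * cos \<theta> * sin \<theta>"
            using c by (simp add: field_simps power2_eq_square power3_eq_cube)
          then show ?thesis using c s that by (simp flip: ennreal_mult)
        qed
        then show "ennreal \<bar>2 * sin \<theta> / (cos \<theta>) ^ 3\<bar> *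
           (ennreal \<bar>2 * r * (cos \<theta>)\<^sup>2\<bar> * ?g (r\<^sup>2 * (cos \<theta>)\<^sup>2) * indicator {0<..} r) =
           ennreal (4 * r ^ 3 * cos \<theta> * sin \<theta>) *
          f (r\<^sup>2 * (cos \<theta>)\<^sup>2, r\<^sup>2 * (sin \<theta>)\<^sup>2) * indicator {0<..} r"
          using c by (auto split: split_indicator simp: mult.assoc[symmetric])
      qed
      finally show ?thesis using True by simp
    qed simp
  qed
  finally show ?thesis .
qed

section \<open>Transfer to integrals with values in Banach spaces\<close>

text \<open>Applying the nonnegative formula to indicators of measurable sets identifies Lebesgue
  measure on the quadrant as an image measure. Points are pairs (\<theta>, r). The density is a real
  function under \<open>ennreal\<close>, as the rules for Bochner integrals over a
  \<open>density\<close> require.\<close>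

lemma density_quadrant_eq_distr_polar_squared:
  "density (lborel \<Otimes>\<^sub>M lborel) (indicator ({0<..} \<times> {0<..})) =
   distr (density (lborel \<Otimes>\<^sub>M lborel)
     (\<lambda>z. ennreal (indicator ({0<..<pi/2} \<times> {0<..}) z * (4 * snd z ^ 3 * cos (fst z) * sin (fst z)))))
     (lborel \<Otimes>\<^sub>M lborel)
     (\<lambda>z::real \<times> real. ((snd z)\<^sup>2 * (cos (fst z))\<^sup>2, (snd z)\<^sup>2 * (sin (fst z))\<^sup>2))"
  (is "?M = distr (density _ ?J) _ ?\<Phi>")
proof (rule measure_eqI)
  fix A assume "A \<in> sets ?M"
  then have A [measurable]: "A \<in> sets (lborel \<Otimes>\<^sub>M lborel)" by simp
  have \<Phi> [measurable]: "?\<Phi> \<in> lborel \<Otimes>\<^sub>M lborel \<rightarrow>\<^sub>M lborel \<Otimes>\<^sub>M lborel" by measurable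
  have "emeasure ?M A = (\<integral>\<^sup>+z. indicator ({0<..} \<times> {0<..}) z * indicator A z \<partial>(lborel \<Otimes>\<^sub>M lborel))"
    by (rule emeasure_density) measurable
  also have "\<dots> = (\<integral>\<^sup>+u. \<integral>\<^sup>+v. indicator ({0<..} \<times> {0<..}) (u, v) * indicator A (u, v) \<partial>lborel \<partial>lborel)"
    by (rule lborel.nn_integral_fst[symmetric]) measurable
  also have "\<dots> = (\<integral>\<^sup>+u. (\<integral>\<^sup>+v. indicator A (u, v) * indicator {0<..} v \<partial>lborel) * indicator {0<..} u \<partial>lborel)"
    by (simp add: indicator_times nn_integral_cmult ac_simps)
  also have "\<dots> = (\<integral>\<^sup>+\<theta>. (\<integral>\<^sup>+r. ennreal (4 * r ^ 3 * cos \<theta> * sin \<theta>) *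
       indicator A (?\<Phi> (\<theta>, r)) * indicator {0<..} r \<partial>lborel) * indicator {0<..<pi/2} \<theta> \<partial>lborel)"
    by (subst nn_integral_quadrant_polar_squared) simp_all
  also have "\<dots> = (\<integral>\<^sup>+\<theta>. \<integral>\<^sup>+r. ?J (\<theta>, r) * indicator A (?\<Phi> (\<theta>, r)) \<partial>lborel \<partial>lborel)"
    by (subst nn_integral_multc[symmetric])
       (auto intro!: nn_integral_cong split: split_indicator)
  also have "\<dots> = (\<integral>\<^sup>+z. ?J z * indicator A (?\<Phi> z) \<partial>(lborel \<Otimes>\<^sub>M lborel))"
    by (rule lborel.nn_integral_fst) measurable
  also have "\<dots> = emeasure (distr (density (lborel \<Otimes>\<^sub>M lborel) ?J) (lborel \<Otimes>\<^sub>M lborel) ?\<Phi>) A"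
    using A by (subst nn_integral_indicator[symmetric])
       (simp_all add: nn_integral_distr nn_integral_density del: nn_integral_indicator)
  finally show "emeasure ?M A =
      emeasure (distr (density (lborel \<Otimes>\<^sub>M lborel) ?J) (lborel \<Otimes>\<^sub>M lborel) ?\<Phi>) A" .
qed simp

text \<open>Both claims follow by reading the integral of \<open>f\<close> over the same measure in
  two ways: as a density on the quadrant, and as an image under the coordinate map. Integrability of
  \<open>F\<close> is thus obtained from that of \<open>f\<close>.\<close>

lemma quadrant_polar_squared:
  fixes f :: "real \<times> real \<Rightarrow> 'b::{banach, second_countable_topology}"
  assumes [measurable]: "f \<in> borel_measurable (lborel \<Otimes>\<^sub>M lborel)"
    and f: "set_integrable (lborel \<Otimes>\<^sub>M lborel) ({0<..} \<times> {0<..}) f"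
  defines "F \<equiv> \<lambda>z. (4 * snd z ^ 3 * cos (fst z) * sin (fst z)) *\<^sub>R
     f ((snd z)\<^sup>2 * (cos (fst z))\<^sup>2, (snd z)\<^sup>2 * (sin (fst z))\<^sup>2)"
  shows "set_integrable (lborel \<Otimes>\<^sub>M lborel) ({0<..<pi/2} \<times> {0<..}) F"
    and "(LINT z:{0<..<pi/2} \<times> {0<..}|(lborel \<Otimes>\<^sub>M lborel). F z) =
         (LINT z:{0<..} \<times> {0<..}|(lborel \<Otimes>\<^sub>M lborel). f z)"
proof -
  let ?Q = "indicator ({0<..} \<times> {0<..}) :: real \<times> real \<Rightarrow> real"
  let ?J = "\<lambda>z. indicator ({0<..<pi/2} \<times> {0<..}) z * (4 * snd z ^ 3 * cos (fst z) * sin (fst z)) :: real"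
  let ?\<Phi> = "\<lambda>z::real \<times> real. ((snd z)\<^sup>2 * (cos (fst z))\<^sup>2, (snd z)\<^sup>2 * (sin (fst z))\<^sup>2)"
  have [measurable]: "?\<Phi> \<in> lborel \<Otimes>\<^sub>M lborel \<rightarrow>\<^sub>M lborel \<Otimes>\<^sub>M lborel" by measurable
  have eq: "density (lborel \<Otimes>\<^sub>M lborel) (\<lambda>z. ennreal (?Q z)) =
      distr (density (lborel \<Otimes>\<^sub>M lborel) (\<lambda>z. ennreal (?J z))) (lborel \<Otimes>\<^sub>M lborel) ?\<Phi>"
    using density_quadrant_eq_distr_polar_squared by (simp add: ennreal_indicator)
  \<comment> \<open>The indicator confines the sine and cosine to the first quadrant and
    \<open>r\<close> to positive values, where the Jacobian has a sign.\<close>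
  have J: "0 \<le> ?J z" for z
    by (auto split: split_indicator intro!: mult_nonneg_nonneg
        simp: cos_ge_zero sin_ge_zero)
  have "integrable (density (lborel \<Otimes>\<^sub>M lborel) (\<lambda>z. ennreal (?Q z))) f"
    using f by (subst integrable_density) (auto simp: set_integrable_def)
  then have "integrable (lborel \<Otimes>\<^sub>M lborel) (\<lambda>z. ?J z *\<^sub>R f (?\<Phi> z))"
    unfolding eq using J by (simp add: integrable_distr_eq integrable_density)
  then show "set_integrable (lborel \<Otimes>\<^sub>M lborel) ({0<..<pi/2} \<times> {0<..}) F"
    by (simp add: set_integrable_def F_def)
  have "(LINT z:{0<..} \<times> {0<..}|(lborel \<Otimes>\<^sub>M lborel). f z) =
      integral\<^sup>L (density (lborel \<Otimes>\<^sub>M lborel) (\<lambda>z. ennreal (?Q z))) f"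
    by (subst integral_density) (auto simp: set_lebesgue_integral_def)
  also have "\<dots> = (LINT z|(lborel \<Otimes>\<^sub>M lborel). ?J z *\<^sub>R f (?\<Phi> z))"
    unfolding eq using J by (simp add: integral_distr integral_density)
  finally show "(LINT z:{0<..<pi/2} \<times> {0<..}|(lborel \<Otimes>\<^sub>M lborel). F z) =
         (LINT z:{0<..} \<times> {0<..}|(lborel \<Otimes>\<^sub>M lborel). f z)"
    by (simp add: set_lebesgue_integral_def F_def)
qed

section \<open>Products of one-variable integrands\<close>

text \<open>Since the norm is multiplicative, the inner integral of the norm is
  \<open>norm (f u)\<close> times a constant, which is integrable in \<open>u\<close>; Fubini then
  applies.\<close>

lemma (in pair_sigma_finite) integrable_mult_fst_snd:
  fixes f :: "_ \<Rightarrow> 'c::{banach, real_normed_div_algebra, second_countable_topology}"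
  assumes f: "integrable M1 f" and g: "integrable M2 g"
  shows "integrable (M1 \<Otimes>\<^sub>M M2) (\<lambda>z. f (fst z) * g (snd z))"
    and "(\<integral>z. f (fst z) * g (snd z) \<partial>(M1 \<Otimes>\<^sub>M M2)) = integral\<^sup>L M1 f * integral\<^sup>L M2 g"
proof -
  have [measurable]: "f \<in> borel_measurable M1" "g \<in> borel_measurable M2"
    using f g by auto
  show int: "integrable (M1 \<Otimes>\<^sub>M M2) (\<lambda>z. f (fst z) * g (snd z))"
    by (rule Fubini_integrable) (use f g in \<open>auto simp: norm_mult\<close>)
  show "(\<integral>z. f (fst z) * g (snd z) \<partial>(M1 \<Otimes>\<^sub>M M2)) = integral\<^sup>L M1 f * integral\<^sup>L M2 g"
    using integral_fst'[OF int] f g by simp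
qed

text \<open>Only exponents have to be compared: 3 + 2(x - 1) + 2(y - 1) = 2(x + y) - 1 for
  \<open>r\<close>, and 1 + 2(x - 1) = 2x - 1 for the cosine, likewise with \<open>y\<close> for the
  sine. The constant 4 of the Jacobian is kept apart, as it stands outside the integral in the final
  formula.\<close>

lemma gamma_ML_integrand_mult_polar:
  fixes r \<theta> :: real
  assumes r: "r > 0" and c: "cos \<theta> > 0" and s: "sin \<theta> > 0"
  shows "(r ^ 3 * cos \<theta> * sin \<theta>) *\<^sub>R
      (gamma_ML_integrand \<alpha> \<beta> \<gamma> p x (r\<^sup>2 * (cos \<theta>)\<^sup>2) * gamma_ML_integrand \<alpha> \<beta> \<gamma> p y (r\<^sup>2 * (sin \<theta>)\<^sup>2)) =
    of_real r powr (2 * (x + y) - 1)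
      * of_real (cos \<theta>) powr (2 * x - 1) * of_real (sin \<theta>) powr (2 * y - 1)
      * mittag_leffler \<alpha> \<beta> \<gamma> (- of_real (r\<^sup>2 * (cos \<theta>)\<^sup>2) - p / of_real (r\<^sup>2 * (cos \<theta>)\<^sup>2))
      * mittag_leffler \<alpha> \<beta> \<gamma> (- of_real (r\<^sup>2 * (sin \<theta>)\<^sup>2) - p / of_real (r\<^sup>2 * (sin \<theta>)\<^sup>2))"
proof -
  \<comment> \<open>For positive real bases the principal logarithm is the real one, so complex
    powers combine without branch corrections.\<close>
  have powr: "complex_of_real t powr w = exp (w * of_real (ln t))" if "t > 0" for t w
    using that by (simp add: powr_def Ln_of_real)
  have powr2: "complex_of_real (r\<^sup>2 * t\<^sup>2) powr w = exp (w * of_real (2 * ln r + 2 * ln t))" if "t > 0" for t w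
    using r that by (subst powr) (simp_all add: ln_mult ln_realpow)
  have *: "complex_of_real (r ^ 3 * cos \<theta> * sin \<theta>) *
      (of_real (r\<^sup>2 * (cos \<theta>)\<^sup>2) powr (x - 1) * of_real (r\<^sup>2 * (sin \<theta>)\<^sup>2) powr (y - 1)) =
      of_real r powr (2 * (x + y) - 1)
      * of_real (cos \<theta>) powr (2 * x - 1) * of_real (sin \<theta>) powr (2 * y - 1)"
  proof -
    \<comment> \<open>With the Jacobian also written as an exponential, the identity becomes an
      equality of exponents.\<close>
    have "r ^ 3 * cos \<theta> * sin \<theta> = exp (3 * ln r + ln (cos \<theta>) + ln (sin \<theta>))"
      using r c s exp_of_nat_mult[of 3 "ln r"] by (simp add: exp_add)
    then have E: "complex_of_real (r ^ 3 * cos \<theta> * sin \<theta>) =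
        exp (of_real (3 * ln r + ln (cos \<theta>) + ln (sin \<theta>)))"
      by (simp only: exp_of_real)
    show ?thesis
      unfolding E powr[OF r] powr[OF c] powr[OF s] powr2[OF c] powr2[OF s] exp_add[symmetric]
      by (simp add: algebra_simps)
  qed
  show ?thesis
    unfolding gamma_ML_integrand_def scaleR_conv_of_real *[symmetric] by (simp only: ac_simps)
qed

section \<open>The product formula as an iterated integral\<close>

text \<open>Because a Lebesgue integral defaults to 0 without integrability, the conclusion also
  asserts that the iterated integral is genuine. Fubini gives integrability of the inner integrand
  for almost every angle.\<close>

theorem theorem2p1:
  fixes \<alpha> \<beta> \<gamma> p x y :: complex
  assumes "Re \<alpha> > 0" and "Re p > 0" and "Re x > 0" and "Re y > 0"
    and "gamma_ML_exists \<alpha> \<beta> \<gamma> p x" and "gamma_ML_exists \<alpha> \<beta> \<gamma> p y"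
  shows "let F = (\<lambda>\<theta> r :: real.
             of_real r powr (2 * (x + y) - 1)
             * of_real (cos \<theta>) powr (2 * x - 1) * of_real (sin \<theta>) powr (2 * y - 1)
             * mittag_leffler \<alpha> \<beta> \<gamma>
                 (- of_real (r\<^sup>2 * (cos \<theta>)\<^sup>2) - p / of_real (r\<^sup>2 * (cos \<theta>)\<^sup>2))
             * mittag_leffler \<alpha> \<beta> \<gamma>
                 (- of_real (r\<^sup>2 * (sin \<theta>)\<^sup>2) - p / of_real (r\<^sup>2 * (sin \<theta>)\<^sup>2)))
         in (AE \<theta> in lborel. \<theta> \<in> {0<..<pi/2} \<longrightarrow> set_integrable lborel {0<..} (F \<theta>))
          \<and> set_integrable lborel {0<..<pi/2} (\<lambda>\<theta>. LINT r:{0<..}|lborel. F \<theta> r)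
          \<and> gamma_ML \<alpha> \<beta> \<gamma> p x * gamma_ML \<alpha> \<beta> \<gamma> p y
              = 4 * (LINT \<theta>:{0<..<pi/2}|lborel. LINT r:{0<..}|lborel. F \<theta> r)"
proof -
  define F where "F = (\<lambda>\<theta> r :: real.
             of_real r powr (2 * (x + y) - 1)
             * of_real (cos \<theta>) powr (2 * x - 1) * of_real (sin \<theta>) powr (2 * y - 1)
             * mittag_leffler \<alpha> \<beta> \<gamma>
                 (- of_real (r\<^sup>2 * (cos \<theta>)\<^sup>2) - p / of_real (r\<^sup>2 * (cos \<theta>)\<^sup>2))
             * mittag_leffler \<alpha> \<beta> \<gamma>
                 (- of_real (r\<^sup>2 * (sin \<theta>)\<^sup>2) - p / of_real (r\<^sup>2 * (sin \<theta>)\<^sup>2)))"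
  \<comment> \<open>Extension by zero turns set integrals into integrals over the whole line or
    plane, where the product and Fubini rules apply.\<close>
  define f where "f z = (\<lambda>t. indicator {0<..} t *\<^sub>R gamma_ML_integrand \<alpha> \<beta> \<gamma> p z t)" for z
  define H where "H = (\<lambda>z. f x (fst z) * f y (snd z))"
  define G where "G = (\<lambda>z. indicator {0<..<pi/2} (fst z) *\<^sub>R indicator {0<..} (snd z) *\<^sub>R F (fst z) (snd z))"
  have f: "integrable lborel (f x)" "integrable lborel (f y)"
    using assms unfolding gamma_ML_exists_def set_integrable_def f_def by auto
  have H: "integrable (lborel \<Otimes>\<^sub>M lborel) H"
      "integral\<^sup>L (lborel \<Otimes>\<^sub>M lborel) H = gamma_ML \<alpha> \<beta> \<gamma> p x * gamma_ML \<alpha> \<beta> \<gamma> p y"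
    using lborel_pair.integrable_mult_fst_snd[OF f]
    by (simp_all add: H_def gamma_ML_def set_lebesgue_integral_def f_def)
  have HQ: "indicator ({0<..} \<times> {0<..}) z *\<^sub>R H z = H z" for z
    by (cases z) (auto simp: H_def f_def split: split_indicator)
  \<comment> \<open>For \<theta> in the interval and \<open>r > 0\<close> both new coordinates are
    positive, so the indicators inside \<open>H\<close> equal 1; elsewhere both sides
    vanish.\<close>
  have HG: "indicator ({0<..<pi/2} \<times> {0<..}) z *\<^sub>R ((4 * snd z ^ 3 * cos (fst z) * sin (fst z)) *\<^sub>R
     H ((snd z)\<^sup>2 * (cos (fst z))\<^sup>2, (snd z)\<^sup>2 * (sin (fst z))\<^sup>2)) = 4 *\<^sub>R G z" for z
  proof (cases z)
    case (Pair \<theta> r)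
    show ?thesis
    proof (cases "\<theta> \<in> {0<..<pi/2} \<and> r > 0")
      case True
      then have "cos \<theta> > 0" "sin \<theta> > 0"
        using cos_gt_zero sin_gt_zero by auto
      with True gamma_ML_integrand_mult_polar[of r \<theta> \<alpha> \<beta> \<gamma> p x y] show ?thesis
        by (simp add: Pair H_def f_def G_def F_def mult.assoc flip: scaleR_scaleR)
    qed (auto simp: Pair G_def split: split_indicator)
  qed
  have "set_integrable (lborel \<Otimes>\<^sub>M lborel) ({0<..} \<times> {0<..}) H"
    unfolding set_integrable_def HQ by (fact H)
  from quadrant_polar_squared[OF borel_measurable_integrable[OF H(1)] this]
  have G4: "integrable (lborel \<Otimes>\<^sub>M lborel) (\<lambda>z. 4 *\<^sub>R G z)"
    and "(LINT z|(lborel \<Otimes>\<^sub>M lborel). 4 *\<^sub>R G z) = integral\<^sup>L (lborel \<Otimes>\<^sub>M lborel) H"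
    unfolding set_integrable_def set_lebesgue_integral_def HG HQ .
  then have eq: "gamma_ML \<alpha> \<beta> \<gamma> p x * gamma_ML \<alpha> \<beta> \<gamma> p y = 4 * integral\<^sup>L (lborel \<Otimes>\<^sub>M lborel) G"
    by (simp add: H scaleR_conv_of_real)
  have G: "integrable (lborel \<Otimes>\<^sub>M lborel) G"
    using integrable_scaleR_right[of "1/4", OF G4] by simp
  \<comment> \<open>The angular indicator does not depend on \<open>r\<close> and leaves the inner
    integral, so Fubini for \<open>G\<close> becomes a statement about set integrals of
    \<open>F\<close>.\<close>
  have inner: "(LINT r|lborel. G (\<theta>, r)) = indicator {0<..<pi/2} \<theta> *\<^sub>R (LINT r:{0<..}|lborel. F \<theta> r)" for \<theta>
    by (simp add: G_def set_lebesgue_integral_def del: scaleR_scaleR)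
  have "AE \<theta> in lborel. \<theta> \<in> {0<..<pi/2} \<longrightarrow> set_integrable lborel {0<..} (F \<theta>)"
    using lborel_pair.AE_integrable_fst'[OF G]
    by eventually_elim (auto simp: G_def set_integrable_def)
  moreover have "set_integrable lborel {0<..<pi/2} (\<lambda>\<theta>. LINT r:{0<..}|lborel. F \<theta> r)"
    using lborel_pair.integrable_fst'[OF G] by (simp add: inner set_integrable_def)
  moreover have "integral\<^sup>L (lborel \<Otimes>\<^sub>M lborel) G = (LINT \<theta>:{0<..<pi/2}|lborel. LINT r:{0<..}|lborel. F \<theta> r)"
    using lborel_pair.integral_fst'[OF G] by (simp add: inner set_lebesgue_integral_def)
  ultimately show ?thesis
    unfolding Let_def F_def[symmetric] using eq by auto
qed

end
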